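(* There exists a sequence of portfolios $\{\mathcal{X}_h\}_{h=1}^m$, each a subset of $\mathcal{C}=\{1,\dots,m\}$, satisfying the nestedness relation $$\mathcal{X}_1\subset\mathcal{X}_2\subset\cdots\subset\mathcal{X}_m$$ such that, for each $h=1,\dots,m$, $\mathcal{X}_h$ is an optimal application portfolio when the application limit is $h$; that is, $|\mathcal{X}_h|\le h$ and $v(\mathcal{X}_h)=\max\{v(\mathcal{X}):\mathcal{X}\subseteq\mathcal{C},\ |\mathcal{X}|\le h\}$.
   Context: Here $0\le t_0<t_1\le\cdots\le t_m$ are real numbers, $f_1,\dots,f_m\in(0,1]$, and $Z_1,\dots,Z_m$ are independent Bernoulli random variables with $\Pr(Z_j=1)=f_j$. The portfolio valuation function is $v(\mathcal{X})=\operatorname{E}\bigl[\max\{t_0,\max\{t_jZ_j: j\in\mathcal{X}\}\}\bigr]$ for $\mathcal{X}\subseteq\mathcal{C}$, with $v(\varnothing)=t_0$. The symbol $\subset$ denotes proper inclusion. *)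

theory Defs
  imports "HOL-Probability.Probability"
begin

definition bernoulli_rv :: "'a measure \<Rightarrow> real \<Rightarrow> ('a \<Rightarrow> real) \<Rightarrow> bool" where
  "bernoulli_rv M p Z \<longleftrightarrow>
     Z \<in> borel_measurable M \<and>
     distr M borel Z = distr (measure_pmf (bernoulli_pmf p)) borel of_bool"

(* The outside option t 0 is inserted as an element of the set, so that the maximum is over a
   nonempty set even for the empty portfolio, whose value is then t 0 on a probability space.
   Meaningful for finite portfolios only. *)
definition portfolio_value ::
  "'a measure \<Rightarrow> (nat \<Rightarrow> real) \<Rightarrow> (nat \<Rightarrow> 'a \<Rightarrow> real) \<Rightarrow> nat set \<Rightarrow> real" where
  "portfolio_value M t Z X =
     (\<integral>\<omega>. Max (insert (t 0) ((\<lambda>j. t j * Z j \<omega>) ` X)) \<partial>M)"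

definition optimal_portfolio ::
  "'a measure \<Rightarrow> (nat \<Rightarrow> real) \<Rightarrow> (nat \<Rightarrow> 'a \<Rightarrow> real) \<Rightarrow> nat \<Rightarrow> nat \<Rightarrow> nat set \<Rightarrow> bool" where
  "optimal_portfolio M t Z m h X \<longleftrightarrow>
     X \<subseteq> {1..m} \<and> card X \<le> h \<and>
     portfolio_value M t Z X =
       Max (portfolio_value M t Z ` {Y. Y \<subseteq> {1..m} \<and> card Y \<le> h})"

end

theory Submission
  imports Defs
begin

text \<open>
  Up to a null set, the maximum over a portfolio is decided by its highest successful application.
  With increasing \<open>t\<close> the value of a portfolio is therefore obtained from the outside option by
  applying the affine maps \<open>w \<mapsto> f j * t j + (1 - f j) * w\<close> in increasing order of \<open>j\<close>.
  Let \<open>k\<close> be an optimal portfolio of size one, that is, let \<open>k\<close> maximize \<open>f k * (t k - t 0)\<close>. A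
  portfolio without \<open>k\<close> does not lose value when its largest element below \<open>k\<close> is replaced by \<open>k\<close> or,
  if there is none, its smallest element above \<open>k\<close>. Hence some optimal portfolio of each size contains
  \<open>k\<close>. Replacing all utilities \<open>x\<close>, including the outside option, by
  \<open>f k * max (t k) x + (1 - f k) * x\<close> removes \<open>k\<close> from the instance, and one concludes by induction on
  the number of applications.
\<close>

section \<open>Portfolio value as a composition of affine maps\<close>

text \<open>Closed form by highest success: the weight of \<open>u j\<close> is the probability that
  \<open>j\<close> succeeds and all larger indices of \<open>X\<close> fail. \<open>f\<close> may
  hold probabilities or 0/1 outcomes, and the base \<open>c\<close> is a parameter so that the value
  of a sub-portfolio can serve as outside option.\<close>

definition expected_best ::
  "(nat \<Rightarrow> real) \<Rightarrow> (nat \<Rightarrow> real) \<Rightarrow> real \<Rightarrow> nat set \<Rightarrow> real" where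
  "expected_best f u c X =
     c * (\<Prod>i\<in>X. 1 - f i) + (\<Sum>j\<in>X. u j * (f j * (\<Prod>i\<in>{i\<in>X. j < i}. 1 - f i)))"

lemma expected_best_empty [simp]: "expected_best f u c {} = c"
  by (simp add: expected_best_def)

text \<open>Conditioning on \<open>j\<close>, the index that decides first: the product belonging to
  \<open>j\<close> is empty, all others gain the factor \<open>1 - f j\<close>.\<close>

lemma expected_best_insert_max:
  assumes "finite X" and "\<And>i. i \<in> X \<Longrightarrow> i < j"
  shows "expected_best f u c (insert j X) = f j * u j + (1 - f j) * expected_best f u c X"
proof -
  have j: "j \<notin> X" using assms(2) by auto
  have top: "(\<Prod>i\<in>{i\<in>insert j X. j < i}. 1 - f i) = 1"
    using assms(2) by (intro prod.neutral) force
  have below: "(\<Prod>i\<in>{i\<in>insert j X. l < i}. 1 - f i) = (1 - f j) * (\<Prod>i\<in>{i\<in>X. l < i}. 1 - f i)"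
    if "l \<in> X" for l
  proof -
    have "{i \<in> insert j X. l < i} = insert j {i \<in> X. l < i}" using assms(2) that by auto
    then show ?thesis using assms(1) j by simp
  qed
  have "expected_best f u c (insert j X) = c * ((1 - f j) * (\<Prod>i\<in>X. 1 - f i)) + (u j * f j
      + (\<Sum>l\<in>X. u l * (f l * ((1 - f j) * (\<Prod>i\<in>{i\<in>X. l < i}. 1 - f i)))))"
    using assms(1) j top below by (simp add: expected_best_def cong: sum.cong)
  also have "\<dots> = f j * u j + (1 - f j) * expected_best f u c X"
    by (simp add: expected_best_def distrib_left sum_distrib_left mult.left_commute mult.commute)
  finally show ?thesis .
qed

lemma expected_best_singleton: "expected_best f u c {j} = f j * u j + (1 - f j) * c"
  using expected_best_insert_max[of "{}" j f u c] by simp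

text \<open>The affine maps of \<open>A\<close> act before those of \<open>B\<close>, so the value
  of \<open>A\<close> plays the outside option for \<open>B\<close>.\<close>

lemma expected_best_Un:
  assumes "finite A" and "finite B" and "\<And>a b. a \<in> A \<Longrightarrow> b \<in> B \<Longrightarrow> a < b"
  shows "expected_best f u c (A \<union> B) = expected_best f u (expected_best f u c A) B"
  using assms(2,3)
proof (induction B rule: finite_linorder_max_induct)
  case empty
  then show ?case by simp
next
  case (insert b B)
  have IH: "expected_best f u c (A \<union> B) = expected_best f u (expected_best f u c A) B"
    using insert by auto
  have "expected_best f u c (insert b (A \<union> B)) = f b * u b + (1 - f b) * expected_best f u c (A \<union> B)"
    using insert assms(1) by (intro expected_best_insert_max) auto
  moreover have "expected_best f u (expected_best f u c A) (insert b B) =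
      f b * u b + (1 - f b) * expected_best f u (expected_best f u c A) B"
    using insert by (intro expected_best_insert_max) auto
  ultimately show ?case using IH by simp
qed

lemma expected_best_cong:
  assumes "\<And>j. j \<in> X \<Longrightarrow> u j = u' j"
  shows "expected_best f u c X = expected_best f u' c X"
  using assms by (simp add: expected_best_def cong: sum.cong)

text \<open>The coefficient of \<open>c\<close> is a product of failure probabilities, hence
  nonnegative.\<close>

lemma expected_best_mono_base:
  assumes "c \<le> c'" and "\<And>i. i \<in> X \<Longrightarrow> f i \<le> 1"
  shows "expected_best f u c X \<le> expected_best f u c' X"
  using assms by (auto simp: expected_best_def intro!: mult_right_mono prod_nonneg)

text \<open>Each step is a convex combination of \<open>u j\<close> and the value so far.\<close>

lemma expected_best_bounds:
  assumes "finite X" and "\<And>i. i \<in> X \<Longrightarrow> 0 \<le> f i \<and> f i \<le> 1"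
    and "\<And>i. i \<in> X \<Longrightarrow> c \<le> u i \<and> u i \<le> b" and "c \<le> b"
  shows "c \<le> expected_best f u c X \<and> expected_best f u c X \<le> b"
  using assms
proof (induction X rule: finite_linorder_max_induct)
  case empty
  then show ?case by simp
next
  case (insert j X)
  have w: "c \<le> expected_best f u c X" "expected_best f u c X \<le> b"
    using insert by auto
  have j: "0 \<le> f j" "0 \<le> 1 - f j" "c \<le> u j" "u j \<le> b" using insert by auto
  have "f j * c + (1 - f j) * c \<le> f j * u j + (1 - f j) * expected_best f u c X"
    using w j by (intro add_mono mult_left_mono) auto
  moreover have "f j * u j + (1 - f j) * expected_best f u c X \<le> f j * b + (1 - f j) * b"
    using w j by (intro add_mono mult_left_mono) auto
  ultimately show ?case
    using insert by (simp add: expected_best_insert_max algebra_simps)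
qed

text \<open>The weights of \<open>c\<close> and of all \<open>u j\<close> sum to one, so an affine
  change of utilities passes through.\<close>

lemma expected_best_affine:
  assumes "finite X"
  shows "expected_best f (\<lambda>j. a + q * u j) (a + q * c) X = a + q * expected_best f u c X"
  using assms
proof (induction X rule: finite_linorder_max_induct)
  case empty
  then show ?case by simp
next
  case (insert j X)
  then show ?case by (simp add: expected_best_insert_max algebra_simps)
qed

section \<open>Elimination of one application\<close>

text \<open>The mean of the better of a sure \<open>x\<close> and an application that yields
  \<open>v\<close> with probability \<open>p\<close>.\<close>

definition merge_with :: "real \<Rightarrow> real \<Rightarrow> real \<Rightarrow> real" where
  "merge_with p v x = p * max v x + (1 - p) * x"

lemma merge_with_below: "x \<le> v \<Longrightarrow> merge_with p v x = p * v + (1 - p) * x"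
  by (simp add: merge_with_def)

lemma merge_with_above: "v \<le> x \<Longrightarrow> merge_with p v x = x"
  by (simp add: merge_with_def algebra_simps)

lemma merge_with_mono:
  assumes "0 \<le> p" "p \<le> 1" "x \<le> y"
  shows "merge_with p v x \<le> merge_with p v y"
  using assms unfolding merge_with_def by (intro add_mono mult_left_mono) auto

lemma split_at:
  fixes k :: "'a::linorder"
  assumes "k \<notin> X"
  shows "X = {i\<in>X. i < k} \<union> {i\<in>X. k < i}"
proof (rule set_eqI)
  fix x
  show "x \<in> X \<longleftrightarrow> x \<in> {i\<in>X. i < k} \<union> {i\<in>X. k < i}"
    using assms by (cases x k rule: linorder_cases) auto
qed

text \<open>For indices below \<open>k\<close>, merging is the affine map of \<open>k\<close>, which
  commutes with the valuation and so may be moved inside; above \<open>k\<close> it is the identity.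
  Monotonicity of \<open>u\<close> and \<open>c \<le> u k\<close> decide the branches.\<close>

lemma expected_best_insert:
  assumes "finite X" and "k \<notin> X"
    and "mono_on (insert k X) u" and "c \<le> u k"
  shows "expected_best f u c (insert k X) =
    expected_best f (\<lambda>j. merge_with (f k) (u k) (u j)) (merge_with (f k) (u k) c) X"
proof -
  define A where "A = {i\<in>X. i < k}"
  define B where "B = {i\<in>X. k < i}"
  define g where "g = merge_with (f k) (u k)"
  have X: "X = A \<union> B" using split_at[OF assms(2)] by (simp add: A_def B_def)
  have fin: "finite A" "finite B" using assms(1) by (simp_all add: A_def B_def)
  have gA: "g (u j) = f k * u k + (1 - f k) * u j" if "j \<in> A" for j
    using that assms(3) unfolding g_def
    by (intro merge_with_below) (auto simp: A_def intro: mono_onD)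
  have gB: "g (u j) = u j" if "j \<in> B" for j
    using that assms(3) unfolding g_def
    by (intro merge_with_above) (auto simp: B_def intro: mono_onD)
  have gc: "g c = f k * u k + (1 - f k) * c"
    using assms(4) by (simp add: g_def merge_with_below)
  have below: "expected_best f (\<lambda>j. g (u j)) (g c) A = expected_best f u c (insert k A)"
  proof -
    have "expected_best f u c (insert k A) = f k * u k + (1 - f k) * expected_best f u c A"
      using fin by (intro expected_best_insert_max) (auto simp: A_def)
    then have "expected_best f (\<lambda>j. f k * u k + (1 - f k) * u j) (f k * u k + (1 - f k) * c) A =
        expected_best f u c (insert k A)"
      using fin by (simp add: expected_best_affine)
    moreover have "expected_best f (\<lambda>j. g (u j)) (g c) A =
        expected_best f (\<lambda>j. f k * u k + (1 - f k) * u j) (f k * u k + (1 - f k) * c) A"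
      unfolding gc by (intro expected_best_cong gA)
    ultimately show ?thesis by simp
  qed
  have "expected_best f u c (insert k X) = expected_best f u c (insert k A \<union> B)"
    by (simp add: X)
  also have "\<dots> = expected_best f u (expected_best f u c (insert k A)) B"
    using fin by (intro expected_best_Un) (auto simp: A_def B_def)
  also have "\<dots> = expected_best f (\<lambda>j. g (u j)) (expected_best f u c (insert k A)) B"
    by (intro expected_best_cong) (simp add: gB)
  also have "\<dots> = expected_best f (\<lambda>j. g (u j)) (g c) (A \<union> B)"
    unfolding below[symmetric] using fin
    by (intro expected_best_Un[symmetric]) (auto simp: A_def B_def)
  finally show ?thesis by (simp add: X g_def)
qed

section \<open>Exchange argument and nested optima\<close>

text \<open>\<open>best\<close> compares gains over \<open>c\<close> only, whereas the swap may
  happen above a value \<open>w \<ge> c\<close>; the order of the utilities bridges the gap. The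
  truncated \<open>card Y - 1\<close> also covers \<open>Y = {}\<close>, where \<open>k\<close> is
  simply added.\<close>

lemma expected_best_exchange:
  assumes "finite Y" and "k \<notin> Y" and "mono_on (insert k Y) u"
    and base: "\<And>i. i \<in> insert k Y \<Longrightarrow> c \<le> u i"
    and f: "\<And>i. i \<in> insert k Y \<Longrightarrow> 0 \<le> f i \<and> f i \<le> 1"
    and best: "\<And>i. i \<in> Y \<Longrightarrow> f i * (u i - c) \<le> f k * (u k - c)"
  shows "\<exists>Y'\<subseteq>Y. card Y' \<le> card Y - 1 \<and> expected_best f u c Y \<le> expected_best f u c (insert k Y')"
proof -
  define A where "A = {i\<in>Y. i < k}"
  define B where "B = {i\<in>Y. k < i}"
  have Y: "Y = A \<union> B" using split_at[OF assms(2)] by (simp add: A_def B_def)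
  have fin: "finite A" "finite B" using assms(1) by (simp_all add: A_def B_def)
  have AB: "\<And>a b. a \<in> A \<Longrightarrow> b \<in> B \<Longrightarrow> a < b" by (auto simp: A_def B_def)
  show ?thesis
  proof (cases "A = {}")
    case False
    define j where "j = Max A"
    define A' where "A' = A - {j}"
    define w where "w = expected_best f u c A'"
    have jA: "j \<in> A" using fin False by (simp add: j_def)
    have A: "A = insert j A'" using jA by (auto simp: A'_def)
    have A'_less: "i < j" if "i \<in> A'" for i
      using that fin Max_ge[of A i] by (auto simp: A'_def j_def order_less_le)
    have finA': "finite A'" using fin by (simp add: A'_def)
    have jk: "u j \<le> u k" using jA assms(3) by (auto simp: A_def intro: mono_onD)
    \<comment> \<open>All of \<open>A'\<close> lies below \<open>j\<close>, so its value stays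
      within \<open>[c, u j]\<close>.\<close>
    have w: "c \<le> w \<and> w \<le> u j"
      unfolding w_def
    proof (rule expected_best_bounds)
      show "finite A'" by fact
      show "0 \<le> f i \<and> f i \<le> 1" if "i \<in> A'" for i using that f by (auto simp: Y A)
      show "c \<le> u i \<and> u i \<le> u j" if "i \<in> A'" for i
        using that base A'_less[OF that] mono_onD[OF assms(3), of i j] by (auto simp: Y A)
      show "c \<le> u j" using base jA by (auto simp: Y)
    qed
    have fj: "0 \<le> f j" "f j \<le> 1" and fk: "0 \<le> f k" and bj: "f j * (u j - c) \<le> f k * (u k - c)"
      using f best jA by (auto simp: Y)
    \<comment> \<open>Passing from base \<open>c\<close> to \<open>w\<close> costs \<open>j\<close>
      at least as much as \<open>k\<close> if \<open>f k \<le> f j\<close>; otherwise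
      \<open>k\<close> is ahead in both factors.\<close>
    have gain: "f j * (u j - w) \<le> f k * (u k - w)"
    proof (cases "f k \<le> f j")
      case True
      then have "f k * (w - c) \<le> f j * (w - c)" using w by (intro mult_right_mono) auto
      then show ?thesis using bj by (simp add: algebra_simps)
    next
      case False
      then show ?thesis using w jk fj by (intro mult_mono) auto
    qed
    have "expected_best f u c A \<le> expected_best f u c (insert k A')"
    proof -
      have "expected_best f u c (insert k A') = f k * u k + (1 - f k) * w"
        unfolding w_def using finA' A'_less jA
        by (intro expected_best_insert_max) (auto simp: A'_def A_def)
      moreover have "expected_best f u c A = f j * u j + (1 - f j) * w"
        unfolding w_def A using finA' A'_less by (intro expected_best_insert_max) auto
      ultimately show ?thesis using gain by (simp add: algebra_simps)
    qed
    \<comment> \<open>The block above \<open>k\<close> is unchanged, and its value is monotone in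
      its base.\<close>
    then have "expected_best f u (expected_best f u c A) B
        \<le> expected_best f u (expected_best f u c (insert k A')) B"
      using f by (intro expected_best_mono_base) (auto simp: Y)
    moreover have "expected_best f u c Y = expected_best f u (expected_best f u c A) B"
      unfolding Y using fin AB by (intro expected_best_Un) auto
    moreover have "expected_best f u c (insert k A' \<union> B) =
        expected_best f u (expected_best f u c (insert k A')) B"
      using fin finA' by (intro expected_best_Un) (auto simp: A'_def A_def B_def)
    ultimately have "expected_best f u c Y \<le> expected_best f u c (insert k (A' \<union> B))" by simp
    moreover have YAB: "A' \<union> B = Y - {j}" using jA AB by (auto simp: Y A'_def)
    moreover have "card (Y - {j}) = card Y - 1" using jA assms(1) by (simp add: Y)
    ultimately show ?thesis by (intro exI[of _ "A' \<union> B"]) auto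
  next
    case empty: True
    show ?thesis
    proof (cases "Y = {}")
      case True
      have "f k * (u k - c) \<ge> 0" using f base by auto
      then show ?thesis using True by (simp add: expected_best_singleton algebra_simps)
    next
      case False
      define j where "j = Min Y"
      define B' where "B' = Y - {j}"
      have jY: "j \<in> Y" using assms(1) False by (simp add: j_def)
      have kY: "k < i" if "i \<in> Y" for i
        using that empty assms(2) by (cases i k rule: linorder_cases) (auto simp: A_def)
      have jB': "j < i" if "i \<in> B'" for i
        using that Min_le[OF assms(1), of i] by (auto simp: B'_def j_def order_less_le)
      have finB': "finite B'" using assms(1) by (simp add: B'_def)
      \<comment> \<open>Nothing lies below \<open>k\<close>, so \<open>j\<close> and
        \<open>k\<close> both act directly on \<open>c\<close> and \<open>best\<close> applies as it
        stands.\<close>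
      have "expected_best f u c {j} \<le> expected_best f u c {k}"
        using best[OF jY] by (simp add: expected_best_singleton algebra_simps)
      then have "expected_best f u (expected_best f u c {j}) B' \<le>
          expected_best f u (expected_best f u c {k}) B'"
        using f by (intro expected_best_mono_base) (auto simp: B'_def)
      moreover have "expected_best f u c ({j} \<union> B') = expected_best f u (expected_best f u c {j}) B'"
        using finB' jB' by (intro expected_best_Un) auto
      moreover have "expected_best f u c ({k} \<union> B') = expected_best f u (expected_best f u c {k}) B'"
        using finB' kY by (intro expected_best_Un) (auto simp: B'_def)
      moreover have "Y = {j} \<union> B'" using jY by (auto simp: B'_def)
      ultimately have "expected_best f u c Y \<le> expected_best f u c (insert k B')" by simp
      moreover have "card B' = card Y - 1" using jY assms(1) by (simp add: B'_def)
      ultimately show ?thesis by (intro exI[of _ B']) (auto simp: B'_def)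
    qed
  qed
qed

text \<open>Utilities and base stay arbitrary in the induction, since eliminating \<open>k\<close>
  changes both. Level 0 is included because level \<open>h\<close> of the reduced instance yields
  level \<open>Suc h\<close>.\<close>

lemma nested_optimal_sets:
  assumes "finite C" and "mono_on C u"
    and "\<And>i. i \<in> C \<Longrightarrow> c \<le> u i" and f: "\<And>i. i \<in> C \<Longrightarrow> 0 \<le> f i \<and> f i \<le> 1"
  shows "\<exists>X. (\<forall>h<card C. X h \<subset> X (Suc h)) \<and>
    (\<forall>h\<le>card C. X h \<subseteq> C \<and> card (X h) = h) \<and>
    (\<forall>h\<le>card C. \<forall>Y\<subseteq>C. card Y \<le> h \<longrightarrow> expected_best f u c Y \<le> expected_best f u c (X h))"
  using assms
proof (induction "card C" arbitrary: C u c)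
  case 0
  then have "C = {}" by simp
  then show ?case by (intro exI[of _ "\<lambda>_. {}"]) auto
next
  case (Suc n)
  note finC = \<open>finite C\<close> and mono = \<open>mono_on C u\<close> and base = Suc.prems(3) and f = Suc.prems(4)
  have "C \<noteq> {}" using Suc.hyps(2) by auto
  then have "Max ((\<lambda>i. f i * (u i - c)) ` C) \<in> (\<lambda>i. f i * (u i - c)) ` C"
    using finC by (intro Max_in) auto
  then obtain k where kC: "k \<in> C" and "f k * (u k - c) = Max ((\<lambda>i. f i * (u i - c)) ` C)"
    by auto
  then have best: "f i * (u i - c) \<le> f k * (u k - c)" if "i \<in> C" for i
    using that finC by simp
  define C' where "C' = C - {k}"
  define g where "g = merge_with (f k) (u k)"
  have g_mono: "g x \<le> g y" if "x \<le> y" for x y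
    using that f[OF kC] by (simp add: g_def merge_with_mono)
  have cardC': "card C' = n" using Suc.hyps(2) kC finC by (simp add: C'_def)
  \<comment> \<open>Portfolios containing \<open>k\<close> correspond to portfolios of the smaller
    instance, with utilities and base passed through \<open>g\<close>.\<close>
  have elim: "expected_best f u c (insert k Y) = expected_best f (\<lambda>j. g (u j)) (g c) Y"
    if "Y \<subseteq> C'" for Y
    unfolding g_def
  proof (rule expected_best_insert)
    show "finite Y" using that finC by (auto simp: C'_def intro: finite_subset)
    show "k \<notin> Y" using that by (auto simp: C'_def)
    show "mono_on (insert k Y) u" using mono that kC by (auto simp: C'_def intro: mono_on_subset)
    show "c \<le> u k" using base kC by auto
  qed
  have "\<exists>X. (\<forall>h<card C'. X h \<subset> X (Suc h)) \<and>
    (\<forall>h\<le>card C'. X h \<subseteq> C' \<and> card (X h) = h) \<and>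
    (\<forall>h\<le>card C'. \<forall>Y\<subseteq>C'. card Y \<le> h \<longrightarrow>
      expected_best f (\<lambda>j. g (u j)) (g c) Y \<le> expected_best f (\<lambda>j. g (u j)) (g c) (X h))"
  proof (rule Suc.hyps(1))
    show "n = card C'" using cardC' by simp
    show "finite C'" using finC by (simp add: C'_def)
    \<comment> \<open>\<open>g\<close> is monotone, so the reduced instance is still sorted, with
      its base at the bottom.\<close>
    show "mono_on C' (\<lambda>j. g (u j))"
      using mono by (auto simp: C'_def intro!: mono_onI g_mono dest: mono_onD)
    show "g c \<le> g (u i)" if "i \<in> C'" for i using that base by (auto simp: C'_def intro: g_mono)
    show "0 \<le> f i \<and> f i \<le> 1" if "i \<in> C'" for i using that f by (auto simp: C'_def)
  qed
  then obtain X where nested: "\<forall>h<n. X h \<subset> X (Suc h)"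
    and X: "\<forall>h\<le>n. X h \<subseteq> C' \<and> card (X h) = h"
    and opt: "\<forall>h\<le>n. \<forall>Y\<subseteq>C'. card Y \<le> h \<longrightarrow>
      expected_best f (\<lambda>j. g (u j)) (g c) Y \<le> expected_best f (\<lambda>j. g (u j)) (g c) (X h)"
    unfolding cardC' by blast
  \<comment> \<open>Index shift: \<open>k\<close> takes one slot, so level \<open>Suc i\<close>
    extends level \<open>i\<close> of the reduced instance.\<close>
  define X' where "X' h = (case h of 0 \<Rightarrow> {} | Suc i \<Rightarrow> insert k (X i))" for h
  have finX: "finite (X h)" "k \<notin> X h" if "h \<le> n" for h
    using X[rule_format, OF that] finC by (auto simp: C'_def intro: finite_subset)
  have with_k: "expected_best f u c (insert k Y) \<le> expected_best f u c (X' (Suc h))"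
    if "h \<le> n" "Y \<subseteq> C'" "card Y \<le> h" for h Y
    using that opt[rule_format, of h Y] X[rule_format, of h] by (simp add: elim X'_def)
  \<comment> \<open>Competitors containing \<open>k\<close> are compared in the reduced instance;
    any other is first exchanged for one containing \<open>k\<close>.\<close>
  have optX': "expected_best f u c Y \<le> expected_best f u c (X' (Suc h))"
    if "h \<le> n" "Y \<subseteq> C" "card Y \<le> Suc h" for h Y
  proof (cases "k \<in> Y")
    case True
    have "finite Y" using that finC by (auto intro: finite_subset)
    then have "expected_best f u c (insert k (Y - {k})) \<le> expected_best f u c (X' (Suc h))"
      using True that by (intro with_k) (auto simp: C'_def)
    then show ?thesis using True by (simp add: insert_absorb)
  next
    case False
    have "\<exists>Y'\<subseteq>Y. card Y' \<le> card Y - 1 \<and>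
      expected_best f u c Y \<le> expected_best f u c (insert k Y')"
    proof (rule expected_best_exchange)
      show "finite Y" using that finC by (auto intro: finite_subset)
      show "mono_on (insert k Y) u" using mono that kC by (auto intro: mono_on_subset)
    qed (use False that kC base f best in auto)
    then obtain Y' where Y': "Y' \<subseteq> Y" "card Y' \<le> card Y - 1"
      "expected_best f u c Y \<le> expected_best f u c (insert k Y')" by blast
    moreover have "expected_best f u c (insert k Y') \<le> expected_best f u c (X' (Suc h))"
      using False Y' that by (intro with_k) (auto simp: C'_def)
    ultimately show ?thesis by simp
  qed
  have "X' h \<subset> X' (Suc h)" if "h < card C" for h
  proof (cases h)
    case (Suc i)
    then have "i < n" using that \<open>Suc n = card C\<close> by simp
    \<comment> \<open>\<open>k\<close> is not in \<open>X (Suc i)\<close>, so adding it to both sets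
      keeps the inclusion strict.\<close>
    then show ?thesis using Suc nested[rule_format, of i] finX(2)[of "Suc i"] by (auto simp: X'_def)
  qed (simp add: X'_def psubset_eq)
  moreover have "X' h \<subseteq> C \<and> card (X' h) = h \<and>
      (\<forall>Y\<subseteq>C. card Y \<le> h \<longrightarrow> expected_best f u c Y \<le> expected_best f u c (X' h))"
    if "h \<le> card C" for h
  proof (cases h)
    case 0
    \<comment> \<open>\<open>card Y \<le> 0\<close> gives \<open>Y = {}\<close> only once
      \<open>Y\<close> is known to be finite: infinite sets also have \<open>card\<close> 0.\<close>
    then show ?thesis using finC by (auto simp: X'_def dest: finite_subset)
  next
    case (Suc i)
    then have "i \<le> n" using that \<open>Suc n = card C\<close> by simp
    then show ?thesis
      using Suc optX'[of i] finX[of i] X[rule_format, of i] kC by (auto simp: X'_def C'_def)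
  qed
  ultimately show ?case by blast
qed

section \<open>Bernoulli outcomes and expectations\<close>

text \<open>Only the law of \<open>W\<close> is prescribed, so its two values are pulled back from
  the distribution and hold almost surely.\<close>

lemma (in prob_space) bernoulli_rv_AE:
  assumes "bernoulli_rv M p W"
  shows "AE \<omega> in M. W \<omega> = 0 \<or> W \<omega> = 1"
proof -
  have W: "W \<in> borel_measurable M" and d: "distr M borel W = distr (measure_pmf (bernoulli_pmf p)) borel of_bool"
    using assms by (auto simp: bernoulli_rv_def)
  have "AE x in distr (measure_pmf (bernoulli_pmf p)) borel of_bool. x = 0 \<or> x = (1::real)"
    by (subst AE_distr_iff) auto
  then show ?thesis using W unfolding d[symmetric] by (subst (asm) AE_distr_iff) auto
qed

lemma (in prob_space) bernoulli_rv_expectation: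
  assumes "bernoulli_rv M p W" and "0 \<le> p" and "p \<le> 1"
  shows "integrable M W" and "expectation W = p"
proof -
  have W: "W \<in> borel_measurable M" and d: "distr M borel W = distr (measure_pmf (bernoulli_pmf p)) borel of_bool"
    using assms by (auto simp: bernoulli_rv_def)
  show "integrable M W"
    using bernoulli_rv_AE[OF assms(1)] W by (intro integrable_const_bound[where B = 1]) auto
  have "expectation W = integral\<^sup>L (distr M borel W) (\<lambda>x. x)"
    using W by (simp add: integral_distr)
  also have "\<dots> = measure_pmf.expectation (bernoulli_pmf p) of_bool"
    unfolding d by (subst integral_distr) auto
  also have "\<dots> = p" using assms by simp
  finally show "expectation W = p" .
qed

text \<open>With outcomes \<open>z\<close> as weights, \<open>expected_best\<close> picks the
  utility of the highest success, or \<open>c\<close> if there is none; this is the maximum since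
  \<open>u\<close> is increasing. \<open>0 \<le> c\<close> keeps failed applications, worth 0, from
  mattering.\<close>

lemma Max_eq_expected_best:
  assumes "finite X" and "mono_on X u" and "0 \<le> c" and "\<And>j. j \<in> X \<Longrightarrow> c \<le> u j"
    and "\<And>j. j \<in> X \<Longrightarrow> z j = 0 \<or> z j = 1"
  shows "Max (insert c ((\<lambda>j. u j * z j) ` X)) = expected_best z u c X"
  using assms
proof (induction X rule: finite_linorder_max_induct)
  case empty
  then show ?case by simp
next
  case (insert j X)
  have mono: "mono_on X u" using insert.prems(1) by (rule mono_on_subset) auto
  have IH: "Max (insert c ((\<lambda>j. u j * z j) ` X)) = expected_best z u c X"
    using insert mono by auto
  \<comment> \<open>If \<open>j\<close> succeeds, it is at least as good as everything before
    it.\<close>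
  have "expected_best z u c X \<le> u j"
    unfolding IH[symmetric]
  proof (rule Max.boundedI)
    fix a assume "a \<in> insert c ((\<lambda>j. u j * z j) ` X)"
    moreover have "u i * z i \<le> u j" if "i \<in> X" for i
    proof -
      have "u i \<le> u j" using insert.prems(1) insert.hyps(2) that by (auto intro: mono_onD less_imp_le)
      moreover have "0 \<le> u j" using insert.prems(2) insert.prems(3)[of j] by simp
      ultimately show ?thesis using insert.prems(4)[of i] that by auto
    qed
    ultimately show "a \<le> u j" using insert.prems(3)[of j] by auto
  qed (use insert.hyps in auto)
  \<comment> \<open>If \<open>j\<close> fails, its contribution 0 leaves the maximum
    unchanged.\<close>
  moreover have "0 \<le> expected_best z u c X"
    unfolding IH[symmetric] using insert.prems(2) insert.hyps(1) by (simp add: Max_ge_iff)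
  moreover have "Max (insert c ((\<lambda>j. u j * z j) ` insert j X)) = max (u j * z j) (expected_best z u c X)"
  proof -
    have "insert c ((\<lambda>j. u j * z j) ` insert j X) = insert (u j * z j) (insert c ((\<lambda>j. u j * z j) ` X))"
      by auto
    then show ?thesis using insert.hyps(1) by (simp only: IH[symmetric]) (rule Max_insert, auto)
  qed
  ultimately show ?case
    using insert.prems(4)[of j] insert.hyps by (auto simp: expected_best_insert_max max_def)
qed

text \<open>The closed form is a linear combination of products over distinct indices with factors
  \<open>Z i\<close> or \<open>1 - Z i\<close>; independence takes expectations factor by
  factor.\<close>

lemma (in prob_space) indep_expected_best:
  assumes "finite X" and ind: "indep_vars (\<lambda>_. borel) Z X"
    and int: "\<And>j. j \<in> X \<Longrightarrow> integrable M (Z j)"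
    and ex: "\<And>j. j \<in> X \<Longrightarrow> expectation (Z j) = f j"
  shows "(\<integral>\<omega>. expected_best (\<lambda>j. Z j \<omega>) u c X \<partial>M) = expected_best f u c X"
proof -
  \<comment> \<open>The flag \<open>b\<close> selects success or failure, so one product formula
    covers all terms.\<close>
  define g where "g b x = (if b then x else 1 - x)" for b and x :: real
  have prod_g: "integrable M (\<lambda>\<omega>. \<Prod>i\<in>I. g (b i) (Z i \<omega>))"
    "(\<integral>\<omega>. (\<Prod>i\<in>I. g (b i) (Z i \<omega>)) \<partial>M) = (\<Prod>i\<in>I. g (b i) (f i))" if "I \<subseteq> X" for I b
  proof -
    have "finite I" using that assms(1) by (rule finite_subset)
    have "indep_vars (\<lambda>_. borel) (\<lambda>i \<omega>. g (b i) (Z i \<omega>)) I"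
      using indep_vars_subset[OF ind that] by (rule indep_vars_compose2) (simp add: g_def)
    moreover have i: "integrable M (\<lambda>\<omega>. g (b i) (Z i \<omega>))" if "i \<in> I" for i
      using int[of i] that \<open>I \<subseteq> X\<close> by (cases "b i") (auto simp: g_def)
    moreover have e: "(\<integral>\<omega>. g (b i) (Z i \<omega>) \<partial>M) = g (b i) (f i)" if "i \<in> I" for i
      using int[of i] ex[of i] that \<open>I \<subseteq> X\<close>
      by (cases "b i") (auto simp: g_def prob_space)
    ultimately show "integrable M (\<lambda>\<omega>. \<Prod>i\<in>I. g (b i) (Z i \<omega>))"
      "(\<integral>\<omega>. (\<Prod>i\<in>I. g (b i) (Z i \<omega>)) \<partial>M) = (\<Prod>i\<in>I. g (b i) (f i))"
      using \<open>finite I\<close> by (simp_all add: indep_vars_integrable indep_vars_lebesgue_integral)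
  qed
  \<comment> \<open>With flag \<open>i = j\<close>, the factor of \<open>j\<close> is a success and
    all later ones are failures. Arbitrary \<open>z\<close> allows use for outcomes and for
    probabilities.\<close>
  have tail: "z j * (\<Prod>i\<in>{i\<in>X. j < i}. 1 - z i) = (\<Prod>i\<in>insert j {i\<in>X. j < i}. g (i = j) (z i))"
    for z :: "nat \<Rightarrow> real" and j
    using assms(1) by (auto simp: g_def intro!: prod.cong)
  have int_all: "integrable M (\<lambda>\<omega>. \<Prod>i\<in>X. 1 - Z i \<omega>)"
    and ex_all: "(\<integral>\<omega>. (\<Prod>i\<in>X. 1 - Z i \<omega>) \<partial>M) = (\<Prod>i\<in>X. 1 - f i)"
    using prod_g[of X "\<lambda>_. False"] by (simp_all add: g_def)
  have int_tail: "integrable M (\<lambda>\<omega>. Z j \<omega> * (\<Prod>i\<in>{i\<in>X. j < i}. 1 - Z i \<omega>))"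
    and ex_tail: "(\<integral>\<omega>. Z j \<omega> * (\<Prod>i\<in>{i\<in>X. j < i}. 1 - Z i \<omega>) \<partial>M) =
      f j * (\<Prod>i\<in>{i\<in>X. j < i}. 1 - f i)" if "j \<in> X" for j
    using that prod_g[of "insert j {i\<in>X. j < i}" "\<lambda>i. i = j"]
    unfolding tail[of f j] tail[of "\<lambda>i. Z i _" j] by auto
  show ?thesis
    unfolding expected_best_def
    by (subst Bochner_Integration.integral_add) (simp_all add: int_all ex_all int_tail ex_tail)
qed

section \<open>Transfer to portfolio values\<close>

theorem theorem3:
  fixes M :: "'a measure" and Z :: "nat \<Rightarrow> 'a \<Rightarrow> real"
    and t f :: "nat \<Rightarrow> real" and m :: nat
  assumes "prob_space M"
    and "m \<ge> 1"
    and "0 \<le> t 0" and "t 0 < t 1"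
    and "\<And>j. 1 \<le> j \<Longrightarrow> j < m \<Longrightarrow> t j \<le> t (Suc j)"
    and "\<And>j. j \<in> {1..m} \<Longrightarrow> 0 < f j \<and> f j \<le> 1"
    and "\<And>j. j \<in> {1..m} \<Longrightarrow> bernoulli_rv M (f j) (Z j)"
    and "prob_space.indep_vars M (\<lambda>_. borel) Z {1..m}"
  shows "\<exists>X :: nat \<Rightarrow> nat set.
           (\<forall>h. 1 \<le> h \<and> h < m \<longrightarrow> X h \<subset> X (Suc h)) \<and>
           (\<forall>h\<in>{1..m}. optimal_portfolio M t Z m h (X h))"
proof -
  interpret prob_space M by fact
  have t_le: "t i \<le> t j" if "1 \<le> i" "i \<le> j" "j \<le> m" for i j
    using that(2,3,1)
  proof (induction j rule: dec_induct)
    case (step l)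
    then show ?case using assms(5)[of l] by force
  qed simp
  have mono: "mono_on {1..m} t" using t_le by (auto intro: mono_onI)
  have t0: "t 0 \<le> t j" if "j \<in> {1..m}" for j
    using that t_le[of 1 j] assms(4) by auto
  have f01: "0 \<le> f j \<and> f j \<le> 1" if "j \<in> {1..m}" for j using assms(6)[OF that] by auto
  \<comment> \<open>The pointwise formula holds off a null set; taking expectations turns the
    outcomes \<open>Z j\<close> into \<open>f j\<close>.\<close>
  have pv: "portfolio_value M t Z X = expected_best f t (t 0) X" if X: "X \<subseteq> {1..m}" for X
  proof -
    have fin: "finite X" using X by (rule finite_subset) simp
    have rv: "Z j \<in> borel_measurable M" if "j \<in> X" for j
      using assms(7)[of j] X that by (auto simp: bernoulli_rv_def)
    have "AE \<omega> in M. \<forall>j\<in>X. Z j \<omega> = 0 \<or> Z j \<omega> = 1"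
      using X by (intro AE_finite_allI[OF fin] bernoulli_rv_AE[OF assms(7)]) auto
    then have "AE \<omega> in M. Max (insert (t 0) ((\<lambda>j. t j * Z j \<omega>) ` X)) =
        expected_best (\<lambda>j. Z j \<omega>) t (t 0) X"
    proof eventually_elim
      case (elim \<omega>)
      then show ?case
        using X t0 assms(3) by (intro Max_eq_expected_best fin mono_on_subset[OF mono]) auto
    qed
    moreover have "(\<lambda>\<omega>. Max (insert (t 0) ((\<lambda>j. t j * Z j \<omega>) ` X))) \<in> borel_measurable M"
    \<comment> \<open>For nonempty \<open>X\<close> the outside option is split off as a binary
      \<open>max\<close>; for empty \<open>X\<close> the integrand is constant.\<close>
    proof (cases "X = {}")
      case False
      then have "(\<lambda>\<omega>. Max (insert (t 0) ((\<lambda>j. t j * Z j \<omega>) ` X))) =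
          (\<lambda>\<omega>. max (t 0) (Max ((\<lambda>j. t j * Z j \<omega>) ` X)))"
        using fin by simp
      then show ?thesis using rv fin by simp
    qed simp
    ultimately have "portfolio_value M t Z X = (\<integral>\<omega>. expected_best (\<lambda>j. Z j \<omega>) t (t 0) X \<partial>M)"
      unfolding portfolio_value_def expected_best_def using rv fin
      by (intro integral_cong_AE) auto
    also have "\<dots> = expected_best f t (t 0) X"
    proof (rule indep_expected_best)
      fix j assume "j \<in> X"
      then have j: "j \<in> {1..m}" using X by blast
      show "integrable M (Z j)" "expectation (Z j) = f j"
        using bernoulli_rv_expectation[OF assms(7)[OF j]] f01[OF j] by auto
    qed (use fin X indep_vars_subset[OF assms(8)] in auto)
    finally show ?thesis .
  qed
  have "\<exists>X. (\<forall>h<card {1..m}. X h \<subset> X (Suc h)) \<and>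
    (\<forall>h\<le>card {1..m}. X h \<subseteq> {1..m} \<and> card (X h) = h) \<and>
    (\<forall>h\<le>card {1..m}. \<forall>Y\<subseteq>{1..m}. card Y \<le> h \<longrightarrow>
      expected_best f t (t 0) Y \<le> expected_best f t (t 0) (X h))"
    by (rule nested_optimal_sets) (use mono t0 f01 in auto)
  then obtain X where nested: "\<forall>h<m. X h \<subset> X (Suc h)"
    and X: "\<forall>h\<le>m. X h \<subseteq> {1..m} \<and> card (X h) = h"
    and opt: "\<forall>h\<le>m. \<forall>Y\<subseteq>{1..m}. card Y \<le> h \<longrightarrow>
      expected_best f t (t 0) Y \<le> expected_best f t (t 0) (X h)"
    unfolding card_atLeastAtMost diff_Suc_1 by auto
  have "optimal_portfolio M t Z m h (X h)" if "h \<le> m" for h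
  proof -
    \<comment> \<open>\<open>X h\<close> is itself feasible and dominates every competitor, so the
      maximum is attained there.\<close>
    have "Max (portfolio_value M t Z ` {Y. Y \<subseteq> {1..m} \<and> card Y \<le> h}) = portfolio_value M t Z (X h)"
      using that X opt by (intro Max_eqI) (auto simp: pv)
    then show ?thesis using that X by (simp add: optimal_portfolio_def)
  qed
  then show ?thesis using nested by (intro exI[of _ X]) auto
qed

end
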